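(* Let $n\ge1$ and let $q\in(-\infty,1]$ with $q\neq0$. Let $\mu$ be any $\sigma$-finite $q$-homogeneous Borel measure on $\mathbb{R}^n$. Then $\mu$ is $q$-complemented concave, that is: for all $\lambda\in(0,1)$ and all Borel sets $A,B\subset\mathbb{R}^n$ with $\mu(\mathbb{R}^n\setminus A),\mu(\mathbb{R}^n\setminus B)<\infty$, $$\mu_*\big(\mathbb{R}^n\setminus(\lambda A+(1-\lambda)B)\big)\le\big(\lambda\,\mu(\mathbb{R}^n\setminus A)^q+(1-\lambda)\,\mu(\mathbb{R}^n\setminus B)^q\big)^{1/q}.$$
   Context: A Borel measure $\mu$ on $\mathbb{R}^n$ is $q$-homogeneous if $\mu(\lambda A)^q=\lambda\,\mu(A)^q$ (i.e. $\mu(\lambda A)=\lambda^{1/q}\mu(A)$) for every Borel set $A$ and every $\lambda>0$. $\mu_*$ denotes the inner measure induced by $\mu$: $\mu_*(E)=\sup\{\mu(F):F\subset E,\ F\text{ Borel}\}$. $\lambda A+(1-\lambda)B=\{\lambda a+(1-\lambda)b:a\in A,b\in B\}$. When $q<0$ the right-hand side is interpreted by continuity, i.e. it equals $0$ if $\mu(\mathbb{R}^n\setminus A)=0$ or $\mu(\mathbb{R}^n\setminus B)=0$. *)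

theory Defs
  imports "HOL-Analysis.Analysis"
begin

definition homogeneous_measure :: "real \<Rightarrow> 'a::euclidean_space measure \<Rightarrow> bool" where
  "homogeneous_measure q \<mu> \<longleftrightarrow>
     (\<forall>A\<in>sets borel. \<forall>c>0.
        emeasure \<mu> ((\<lambda>x. c *\<^sub>R x) ` A) = ennreal (c powr (1 / q)) * emeasure \<mu> A)"

definition inner_measure :: "'a::topological_space measure \<Rightarrow> 'a set \<Rightarrow> ennreal" where
  "inner_measure \<mu> E = (SUP F\<in>{F \<in> sets borel. F \<subseteq> E}. emeasure \<mu> F)"

definition minkowski_comb :: "real \<Rightarrow> 'a::real_vector set \<Rightarrow> 'a set \<Rightarrow> 'a set" where
  "minkowski_comb l A B = {l *\<^sub>R a + (1 - l) *\<^sub>R b | a b. a \<in> A \<and> b \<in> B}"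

text \<open>The mean of \<open>a, b \<ge> 0\<close> with exponent \<open>q \<noteq> 0\<close>. The first branch is the extension by
  continuity for \<open>q < 0\<close>; it is needed because \<open>0 powr q = 0\<close> for every \<open>q\<close>, negative
  ones included.\<close>

definition power_mean :: "real \<Rightarrow> real \<Rightarrow> real \<Rightarrow> real \<Rightarrow> real" where
  "power_mean q l a b =
     (if q < 0 \<and> (a = 0 \<or> b = 0) then 0
      else (l * a powr q + (1 - l) * b powr q) powr (1 / q))"

text \<open>Both complements are required to have finite measure, so \<^const>\<open>measure\<close> loses no
  information on the right-hand side.\<close>

definition complemented_concave :: "real \<Rightarrow> 'a::euclidean_space measure \<Rightarrow> bool" where
  "complemented_concave q \<mu> \<longleftrightarrow>
     (\<forall>l A B. 0 < l \<longrightarrow> l < 1 \<longrightarrow> A \<in> sets borel \<longrightarrow> B \<in> sets borel \<longrightarrow>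
        emeasure \<mu> (- A) < \<infinity> \<longrightarrow> emeasure \<mu> (- B) < \<infinity> \<longrightarrow>
        inner_measure \<mu> (- minkowski_comb l A B)
          \<le> ennreal (power_mean q l (measure \<mu> (- A)) (measure \<mu> (- B))))"

end

(* On a ray, in the coordinate s of the point s powr q *\<^sub>R x, Minkowski combinations become
   power means M(s, t), and a q-homogeneous measure is an average of Lebesgue measures ds over the
   rays. So one needs a statement about subsets A, B of (0, oo) with small complements: M(A, B) has
   small complement as well. Parametrize A and B by expansive maps X and Y (inverses of their
   cumulative lengths), so that X(t) <= t + |A^c|, Y(t) <= t + |B^c|. As M is superadditive and
   homogeneous, Z(t) = M(X(ut), Y(vt)) takes values in M(A, B) and is expansive with factor M(u, v),
   while Z(t) <= t M(u, v) + alpha |A^c| + beta |B^c|, with (alpha, beta) the gradient of M at (u, v).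
   What Z misses therefore has length at most alpha |A^c| + beta |B^c|. This bound is linear, so it
   integrates over the rays; choosing (u, v) as the measures of the two complements of the original
   sets turns the linear bound back into the power mean. *)

theory Submission imports Defs begin

subsection \<open>Power means and their tangents\<close>

text \<open>For \<open>q\<close> in (0, 1] the exponent \<open>1 / q\<close> is at least 1. For
  \<open>q < 0\<close> it is a negative number p, so p (p - 1) is nonnegative and with it the second
  derivative. This convexity drives the Jensen step behind the tangent bound for means.\<close>

lemma powr_convex_inverse_exponent:
  fixes q :: real
  assumes "q \<le> 1" "q \<noteq> 0"
  shows "convex_on {0<..} (\<lambda>x. x powr (1 / q))"
proof (cases "q > 0")
  case True
  then show ?thesis using assms by (intro powr_convex) auto
next
  case False
  then have "q < 0" using assms by simp
  then have "1 / q < 0" by simp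
  then have "0 \<le> 1 / q * (1 / q - 1)" by (intro mult_nonpos_nonpos) linarith+
  show ?thesis
  proof (rule f''_ge0_imp_convex)
    show "((\<lambda>x. x powr (1 / q)) has_real_derivative 1 / q * x powr (1 / q - 1)) (at x)"
      and "((\<lambda>x. 1 / q * x powr (1 / q - 1)) has_real_derivative
        1 / q * ((1 / q - 1) * x powr (1 / q - 1 - 1))) (at x)"
      if "x \<in> {0<..}" for x
      using that by (intro DERIV_cmult has_real_derivative_powr; simp)+
    show "0 \<le> 1 / q * ((1 / q - 1) * x powr (1 / q - 1 - 1))" for x
      using mult_nonneg_nonneg[OF \<open>0 \<le> 1 / q * (1 / q - 1)\<close> powr_ge_zero]
      by (simp only: mult.assoc)
  qed simp
qed

lemma power_mean_pos_eq:
  assumes "0 < a" "0 < b"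
  shows "power_mean q l a b = (l * a powr q + (1 - l) * b powr q) powr (1 / q)"
  using assms by (simp add: power_mean_def)

text \<open>The partial derivative of the mean in its first argument at (u, v), written through the
  ratio of \<open>u\<close> to the mean; \<open>tangent_r\<close> is the one in the second
  argument.\<close>

definition tangent_l :: "real \<Rightarrow> real \<Rightarrow> real \<Rightarrow> real \<Rightarrow> real" where
  "tangent_l q l u v = l * (u / power_mean q l u v) powr (q - 1)"

definition tangent_r :: "real \<Rightarrow> real \<Rightarrow> real \<Rightarrow> real \<Rightarrow> real" where
  "tangent_r q l u v = (1 - l) * (v / power_mean q l u v) powr (q - 1)"

context
  fixes q l :: real
  assumes q: "q \<le> 1" "q \<noteq> 0" and l: "0 < l" "l < 1"
begin

lemma power_sum_pos: "0 < a \<Longrightarrow> 0 < b \<Longrightarrow> 0 < l * a powr q + (1 - l) * b powr q"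
  using l by (intro add_pos_pos mult_pos_pos) auto

lemma power_mean_pos: "0 < a \<Longrightarrow> 0 < b \<Longrightarrow> 0 < power_mean q l a b"
  using power_sum_pos[of a b] by (simp add: power_mean_pos_eq)

lemma power_mean_powr:
  "0 < a \<Longrightarrow> 0 < b \<Longrightarrow> power_mean q l a b powr q = l * a powr q + (1 - l) * b powr q"
  using power_sum_pos[of a b] q by (simp add: power_mean_pos_eq powr_powr)

lemma power_mean_scale:
  assumes "0 < c" "0 < a" "0 < b"
  shows "power_mean q l (c * a) (c * b) = c * power_mean q l a b"
proof -
  have "l * (c * a) powr q + (1 - l) * (c * b) powr q
      = c powr q * (l * a powr q + (1 - l) * b powr q)"
    using assms by (simp add: powr_mult algebra_simps)
  then show ?thesis
    using assms q power_sum_pos[of a b] by (simp add: power_mean_pos_eq powr_mult powr_powr)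
qed

lemma power_mean_mono:
  assumes "0 < a" "a \<le> a'" "0 < b" "b \<le> b'"
  shows "power_mean q l a b \<le> power_mean q l a' b'"
proof (cases "q > 0")
  case True
  have "l * a powr q + (1 - l) * b powr q \<le> l * a' powr q + (1 - l) * b' powr q"
    using assms l True by (intro add_mono mult_left_mono powr_mono2) auto
  then show ?thesis
    using assms True power_sum_pos[of a b] by (auto simp: power_mean_pos_eq intro!: powr_mono2)
next
  case False
  then have "q < 0" using q by simp
  have "l * a' powr q + (1 - l) * b' powr q \<le> l * a powr q + (1 - l) * b powr q"
    using assms l \<open>q < 0\<close> by (intro add_mono mult_left_mono powr_mono2') auto
  then show ?thesis
    using assms \<open>q < 0\<close> power_sum_pos[of a' b']
    by (auto simp: power_mean_pos_eq intro!: powr_mono2')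
qed

lemma tangent_nonneg: "0 \<le> tangent_l q l u v" "0 \<le> tangent_r q l u v"
  using l by (auto simp: tangent_l_def tangent_r_def)

text \<open>Dividing the defining identity of the mean by \<open>k powr q\<close> produces two
  weights with sum 1. They are the shares of the two gradient terms in \<open>k\<close>, and serve
  below as the coefficients of a convex combination.\<close>

lemma tangent_weights:
  assumes "0 < u" "0 < v"
  defines "k \<equiv> power_mean q l u v"
  shows "tangent_l q l u v * u = k * (l * (u / k) powr q)"
    and "tangent_r q l u v * v = k * ((1 - l) * (v / k) powr q)"
    and "l * (u / k) powr q + (1 - l) * (v / k) powr q = 1"
proof -
  have k: "0 < k" unfolding k_def using assms power_mean_pos by blast
  show "tangent_l q l u v * u = k * (l * (u / k) powr q)"
    using k assms(1) unfolding tangent_l_def k_def[symmetric]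
    by (simp add: powr_diff powr_one)
  show "tangent_r q l u v * v = k * ((1 - l) * (v / k) powr q)"
    using k assms(2) unfolding tangent_r_def k_def[symmetric]
    by (simp add: powr_diff powr_one)
  have "l * (u / k) powr q + (1 - l) * (v / k) powr q
      = (l * u powr q + (1 - l) * v powr q) / k powr q"
    using k assms by (simp add: powr_divide add_divide_distrib)
  also have "\<dots> = 1"
    unfolding k_def power_mean_powr[OF assms(1,2)]
    using power_sum_pos[OF assms(1,2)] by simp
  finally show "l * (u / k) powr q + (1 - l) * (v / k) powr q = 1" .
qed

text \<open>Euler's identity for a function that is homogeneous of degree 1.\<close>

lemma tangent_eq:
  assumes "0 < u" "0 < v"
  shows "tangent_l q l u v * u + tangent_r q l u v * v = power_mean q l u v"
  using tangent_weights(1,2)[OF assms] tangent_weights(3)[OF assms]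
  by (simp only: distrib_left[symmetric] mult_1_right)

text \<open>Concavity of the mean in the form of a supporting plane; by homogeneity the plane passes
  through the origin, so no constant term appears. The inequality is Jensen's for
  \<open>x powr (1 / q)\<close>.\<close>

lemma power_mean_le_tangent:
  assumes uv: "0 < u" "0 < v" and st: "0 < s" "0 < t"
  shows "power_mean q l s t \<le> tangent_l q l u v * s + tangent_r q l u v * t"
proof -
  define k where "k = power_mean q l u v"
  define w1 w2 where "w1 = l * (u / k) powr q" and "w2 = (1 - l) * (v / k) powr q"
  have k: "0 < k" unfolding k_def using uv power_mean_pos by blast
  have w: "0 < w1" "0 < w2" "w1 + w2 = 1"
    using tangent_weights(3)[OF uv] uv k l by (auto simp: w1_def w2_def k_def)
  have "power_mean q l s t = power_mean q l (k * (s / k)) (k * (t / k))"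
    using k by simp
  also have "\<dots> = k * power_mean q l (s / k) (t / k)"
    using k st by (intro power_mean_scale) auto
  \<comment> \<open>Moving the factors u / k and v / k into the weights leaves the ratios s / u and
    t / v, averaged with weights of sum 1, which is the form Jensen's inequality needs.\<close>
  also have "power_mean q l (s / k) (t / k)
      = (w1 * (s / u) powr q + w2 * (t / v) powr q) powr (1 / q)"
  proof -
    have "w1 * (s / u) powr q = l * (s / k) powr q"
      using k uv st by (simp add: w1_def powr_divide)
    moreover have "w2 * (t / v) powr q = (1 - l) * (t / k) powr q"
      using k uv st by (simp add: w2_def powr_divide)
    ultimately show ?thesis using k st by (simp add: power_mean_pos_eq)
  qed
  also have "\<dots> \<le> w1 * ((s / u) powr q) powr (1 / q) + w2 * ((t / v) powr q) powr (1 / q)"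
    using convex_onD[OF powr_convex_inverse_exponent[OF q], of w2 "(s / u) powr q" "(t / v) powr q"]
      w uv st by (simp add: eq_diff_eq[symmetric])
  also have "\<dots> = w1 * (s / u) + w2 * (t / v)"
    using uv st q by (simp add: powr_powr)
  also have "k * \<dots> = tangent_l q l u v * s + tangent_r q l u v * t"
  proof -
    have "k * w1 = tangent_l q l u v * u" "k * w2 = tangent_r q l u v * v"
      using tangent_weights(1,2)[OF uv] by (simp_all add: w1_def w2_def k_def)
    then have "k * (w1 * (s / u)) = tangent_l q l u v * s" "k * (w2 * (t / v)) = tangent_r q l u v * t"
      using uv by (simp_all add: field_simps)
    then show ?thesis by (simp add: distrib_left)
  qed
  finally show ?thesis using k by simp
qed

text \<open>Both means on the left are bounded by the tangent plane at the sum of the two points; by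
  Euler's identity the two bounds add up to the mean at that point.\<close>

lemma power_mean_superadditive:
  assumes "0 < a" "0 < b" "0 < c" "0 < d"
  shows "power_mean q l a b + power_mean q l c d \<le> power_mean q l (a + c) (b + d)"
proof -
  have "power_mean q l a b \<le> tangent_l q l (a + c) (b + d) * a + tangent_r q l (a + c) (b + d) * b"
    "power_mean q l c d \<le> tangent_l q l (a + c) (b + d) * c + tangent_r q l (a + c) (b + d) * d"
    using assms by (auto intro!: power_mean_le_tangent)
  moreover have "tangent_l q l (a + c) (b + d) * (a + c) + tangent_r q l (a + c) (b + d) * (b + d)
      = power_mean q l (a + c) (b + d)"
    using assms by (intro tangent_eq) auto
  ultimately show ?thesis by (simp add: distrib_left)
qed

end

subsection \<open>Sets with small complement on the half-line\<close>

lemma emeasure_lborel_closed_inner: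
  fixes S :: "'a::euclidean_space set" and e :: real
  assumes "S \<in> sets borel" "0 < e"
  obtains C where "closed C" "C \<subseteq> S" "emeasure lborel (S - C) \<le> ennreal e"
proof -
  obtain C where "closed C" "C \<subseteq> S" "S - C \<in> lmeasurable" "emeasure lebesgue (S - C) < ennreal e"
    using sets_lebesgue_inner_closed[of S e] assms by auto
  moreover have "emeasure lebesgue (S - C) = emeasure lborel (S - C)"
    using assms \<open>closed C\<close> by simp
  ultimately show ?thesis using that by auto
qed

lemma fmeasurable_Icc [simp]: "{a..b::real} \<in> fmeasurable lborel"
  by (intro fmeasurableI) (auto simp: emeasure_lborel_Icc_eq)

lemma fmeasurable_Int_Icc [simp]:
  "S \<in> sets borel \<Longrightarrow> S \<inter> {a..b::real} \<in> fmeasurable lborel"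
  by (rule fmeasurableI2[of "{a..b}"]) auto

lemma cumulative_increment:
  fixes C :: "real set"
  assumes "C \<in> sets borel" "x \<le> y"
  shows "measure lborel (C \<inter> {0..x}) \<le> measure lborel (C \<inter> {0..y})"
    and "measure lborel (C \<inter> {0..y}) \<le> measure lborel (C \<inter> {0..x}) + (y - x)"
proof -
  show "measure lborel (C \<inter> {0..x}) \<le> measure lborel (C \<inter> {0..y})"
    using assms by (intro measure_mono_fmeasurable) auto
  have "measure lborel (C \<inter> {0..y}) \<le> measure lborel (C \<inter> {0..x} \<union> {x..y})"
    using assms by (intro measure_mono_fmeasurable fmeasurable.Un) auto
  also have "\<dots> \<le> measure lborel (C \<inter> {0..x}) + measure lborel {x..y}"
    using assms by (intro measure_Un_le) auto
  finally show "measure lborel (C \<inter> {0..y}) \<le> measure lborel (C \<inter> {0..x}) + (y - x)"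
    using assms by simp
qed

text \<open>\<open>X\<close> is a right inverse of the cumulative length \<open>G\<close> of
  \<open>C\<close>. It is expansive because \<open>G\<close> is 1-Lipschitz and nondecreasing, and
  it exceeds \<open>t\<close> by at most \<open>a\<close> because \<open>G\<close> falls short of
  \<open>x\<close> by at most \<open>a\<close>.\<close>

lemma closed_expansive_selection:
  fixes C :: "real set"
  assumes C: "closed C" "C \<subseteq> {0<..}" and a: "emeasure lborel ({0<..} - C) \<le> ennreal a" "0 \<le> a"
  obtains X where "\<And>t. 0 < t \<Longrightarrow> X t \<in> C" "\<And>t. 0 < t \<Longrightarrow> X t \<le> t + a"
    "\<And>s t. 0 < s \<Longrightarrow> s \<le> t \<Longrightarrow> t - s \<le> X t - X s"
proof -
  define G where "G x = measure lborel (C \<inter> {0..x})" for x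
  have Cb: "C \<in> sets borel" using C by auto
  have G_mono: "G x \<le> G y" and G_lip: "G y \<le> G x + (y - x)" if "x \<le> y" for x y
    using cumulative_increment[OF Cb that] by (auto simp: G_def)
  have G0: "G 0 = 0"
  proof -
    have "C \<inter> {0..0} = {}" using C by auto
    then show ?thesis by (simp add: G_def)
  qed
  have G_ge: "x - a \<le> G x" if "0 \<le> x" for x
  proof -
    have fm: "C \<inter> {0..x} \<union> ({0<..x} - C) \<in> fmeasurable lborel"
      by (rule fmeasurableI2[of "{0..x}"]) (use Cb in auto)
    have "x = measure lborel {0<..x}" using that by simp
    also have "\<dots> \<le> measure lborel (C \<inter> {0..x} \<union> ({0<..x} - C))"
      by (rule measure_mono_fmeasurable[OF _ _ fm]) auto
    also have "\<dots> \<le> G x + measure lborel ({0<..x} - C)"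
      unfolding G_def using Cb by (intro measure_Un_le) auto
    also have "measure lborel ({0<..x} - C) \<le> a"
    proof -
      have "emeasure lborel ({0<..x} - C) \<le> emeasure lborel ({0<..} - C)"
        using Cb by (intro emeasure_mono) auto
      also note a(1)
      finally show ?thesis using a(2) by (simp add: measure_def enn2real_leI)
    qed
    finally show ?thesis by simp
  qed
  have G_cont: "continuous_on {0..y} G" for y
  proof (rule continuous_on_subset[OF lipschitz_on_continuous_on, of 1 UNIV])
    show "1-lipschitz_on UNIV G"
    proof (rule lipschitz_onI)
      fix x y :: real
      show "dist (G x) (G y) \<le> 1 * dist x y"
        using G_mono[of x y] G_lip[of x y] G_mono[of y x] G_lip[of y x]
        by (auto simp: dist_real_def abs_real_def not_less)
    qed simp
  qed simp
  have "\<exists>x\<in>C. G x = t" if t: "0 < t" for t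
  proof -
    obtain y where y: "0 \<le> y" "G y = t"
      using IVT'[of G 0 t "t + a"] G_ge[of "t + a"] t a G0 G_cont by auto
    \<comment> \<open>The solution \<open>y\<close> of \<open>G y = t\<close> may lie outside
      \<open>C\<close>. Sliding it down to the last point of \<open>C\<close> before it leaves
      \<open>G\<close> unchanged; such a point exists since \<open>t > 0\<close> forces
      \<open>C\<close> to meet the interval.\<close>
    have "compact (C \<inter> {0..y})" using C by (simp add: closed_Int_compact)
    moreover have "C \<inter> {0..y} \<noteq> {}" using y t by (auto simp: G_def)
    ultimately obtain x where x: "x \<in> C \<inter> {0..y}" "\<And>z. z \<in> C \<inter> {0..y} \<Longrightarrow> z \<le> x"
      using compact_attains_sup[of "C \<inter> {0..y}"] by metis
    have "z \<in> C \<inter> {0..y} \<longleftrightarrow> z \<in> C \<inter> {0..x}" for z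
      using x(1) x(2)[of z] by auto
    then have "C \<inter> {0..y} = C \<inter> {0..x}" by blast
    then have "G x = t" using y(2) by (simp add: G_def)
    then show ?thesis using x(1) by blast
  qed
  then obtain X where X: "\<And>t. 0 < t \<Longrightarrow> X t \<in> C" "\<And>t. 0 < t \<Longrightarrow> G (X t) = t" by metis
  show ?thesis
  proof (rule that[of X])
    show "X t \<le> t + a" if "0 < t" for t
    proof -
      have "0 < X t" using X(1)[OF that] C by auto
      then show ?thesis using G_ge[of "X t"] X(2)[OF that] by simp
    qed
    show "t - s \<le> X t - X s" if "0 < s" "s \<le> t" for s t
    proof (cases "X s \<le> X t")
      case True
      then show ?thesis using G_lip[OF True] X(2)[of s] X(2)[of t] that by simp
    next
      case False
      then have "s = t" using G_mono[of "X t" "X s"] X(2)[of s] X(2)[of t] that by simp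
      then show ?thesis by simp
    qed
  qed (use X in auto)
qed

text \<open>Near \<open>t\<close> an interval around \<open>Z t\<close> is free of \<open>F\<close>, so the inequality holds locally by
  expansiveness; it is then additive over subdivisions.\<close>

lemma expansive_avoids_closed:
  fixes F :: "real set" and Z :: "real \<Rightarrow> real"
  assumes F: "closed F" and k: "0 < k"
    and Z: "\<And>s t. 0 < s \<Longrightarrow> s \<le> t \<Longrightarrow> k * (t - s) \<le> Z t - Z s"
    and avoid: "\<And>t. 0 < t \<Longrightarrow> Z t \<notin> F"
    and st: "0 < s" "s \<le> t"
  shows "k * (t - s) \<le> (Z t - measure lborel (F \<inter> {0..Z t})) - (Z s - measure lborel (F \<inter> {0..Z s}))"
proof -
  \<comment> \<open>For \<open>z \<ge> 0\<close> this is the length of [0, z] outside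
    \<open>F\<close>. It is nondecreasing and has slope 1 on intervals that miss
    \<open>F\<close>.\<close>
  define H where "H z = z - measure lborel (F \<inter> {0..z})" for z
  have Fb: "F \<in> sets borel" using F by auto
  have H_mono: "H x \<le> H y" if "x \<le> y" for x y
    using cumulative_increment[OF Fb that] by (simp add: H_def)
  have H_gap: "H y - H x = y - x" if "x \<le> y" "F \<inter> {x..y} = {}" for x y
  proof -
    have "F \<inter> {0..x} \<union> F \<inter> {x..y} \<supseteq> F \<inter> {0..y}" "F \<inter> {0..x} \<subseteq> F \<inter> {0..y}"
      using that(1) by auto
    then have "F \<inter> {0..y} = F \<inter> {0..x}" using that(2) by blast
    then show ?thesis by (simp add: H_def)
  qed
  have "k * (t - s) \<le> H (Z t) - H (Z s)"
    using st(2)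
  proof (induction rule: Bolzano)
    case (trans a b c)
    then show ?case by (simp add: algebra_simps)
  next
    case (local x)
    then have x: "0 < x" using st by simp
    obtain e where e: "0 < e" "ball (Z x) e \<inter> F = {}"
      using avoid[OF x] F by (metis Compl_iff disjoint_eq_subset_Compl open_Compl open_contains_ball)
    \<comment> \<open>The gap in \<open>F\<close> is known around \<open>Z x\<close> only, so one
      endpoint must be \<open>x\<close>. The point \<open>y\<close> lies at distance
      \<open>k * (b - a)\<close> from \<open>Z x\<close> inside the gap, and expansiveness puts the
      value of \<open>Z\<close> at the other endpoint at \<open>y\<close> or beyond.\<close>
    have step: "k * (b - a) \<le> H (Z b) - H (Z a)"
      if ab: "0 < a" "a \<le> b" "a = x \<or> b = x" "k * (b - a) < e" for a b
    proof (cases "b = x")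
      case True
      define y where "y = Z x - k * (b - a)"
      have "F \<inter> {y..Z x} = {}"
      proof -
        have "{y..Z x} \<subseteq> ball (Z x) e" using ab by (auto simp: dist_real_def y_def)
        then show ?thesis using e by blast
      qed
      then have "H (Z x) - H y = k * (b - a)"
        using H_gap[of y "Z x"] ab k by (simp add: y_def)
      moreover have "H (Z a) \<le> H y"
        using H_mono[of "Z a" y] Z[OF ab(1,2)] True by (simp add: y_def)
      ultimately show ?thesis using True by simp
    next
      case False
      then have ax: "a = x" using ab by simp
      define y where "y = Z x + k * (b - a)"
      have "F \<inter> {Z x..y} = {}"
      proof -
        have "{Z x..y} \<subseteq> ball (Z x) e" using ab by (auto simp: dist_real_def y_def)
        then show ?thesis using e by blast
      qed
      then have "H y - H (Z x) = k * (b - a)"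
        using H_gap[of "Z x" y] ab k by (simp add: y_def)
      moreover have "H y \<le> H (Z b)"
        using H_mono[of y "Z b"] Z[OF ab(1,2)] ax by (simp add: y_def)
      ultimately show ?thesis using ax by simp
    qed
    \<comment> \<open>The bound \<open>x\<close> on the width keeps the left endpoint positive, and
      \<open>e / k\<close> keeps the step in the gap; the inequality then follows by splitting at
      \<open>x\<close>.\<close>
    show ?case
    proof (intro exI[of _ "min x (e / k)"] conjI allI impI)
      show "0 < min x (e / k)" using x e k by simp
      fix a b assume ab: "a \<le> x \<and> x \<le> b \<and> b - a < min x (e / k)"
      then have "0 < a" "k * (b - a) < e" using k by (auto simp: field_simps)
      moreover have "k * (x - a) \<le> k * (b - a)" "k * (b - x) \<le> k * (b - a)"
        using ab k by auto
      ultimately have "k * (x - a) \<le> H (Z x) - H (Z a)" "k * (b - x) \<le> H (Z b) - H (Z x)"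
        using ab x by (auto intro!: step)
      then show "k * (b - a) \<le> H (Z b) - H (Z a)" by (simp add: algebra_simps)
    qed
  qed
  then show ?thesis by (simp add: H_def)
qed

section \<open>The length estimate on a single ray\<close>

text \<open>\<open>Z t\<close> exceeds \<open>k * t\<close> by at most the asserted constant, while
  the part of [0, Z t] outside \<open>F\<close> grows at rate at least \<open>k\<close>. Only the
  constant is left for \<open>F\<close>. Truncation at \<open>R\<close> keeps all lengths
  finite.\<close>

lemma ray_estimate_closed:
  fixes C D F :: "real set"
  assumes q: "q \<le> 1" "q \<noteq> 0" and l: "0 < l" "l < 1" and uv: "0 < u" "0 < v"
    and C: "closed C" "C \<subseteq> {0<..}" "emeasure lborel ({0<..} - C) \<le> ennreal a" "0 \<le> a"
    and D: "closed D" "D \<subseteq> {0<..}" "emeasure lborel ({0<..} - D) \<le> ennreal b" "0 \<le> b"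
    and F: "closed F"
    and sep: "\<And>s t. s \<in> C \<Longrightarrow> t \<in> D \<Longrightarrow> power_mean q l s t \<notin> F"
  shows "measure lborel (F \<inter> {0..R}) \<le> tangent_l q l u v * a + tangent_r q l u v * b"
proof -
  define k where "k = power_mean q l u v"
  have k: "0 < k" unfolding k_def using power_mean_pos q l uv by blast
  obtain X where X: "\<And>t. 0 < t \<Longrightarrow> X t \<in> C" "\<And>t. 0 < t \<Longrightarrow> X t \<le> t + a"
      "\<And>s t. 0 < s \<Longrightarrow> s \<le> t \<Longrightarrow> t - s \<le> X t - X s"
    using closed_expansive_selection[OF C] by blast
  obtain Y where Y: "\<And>t. 0 < t \<Longrightarrow> Y t \<in> D" "\<And>t. 0 < t \<Longrightarrow> Y t \<le> t + b"
      "\<And>s t. 0 < s \<Longrightarrow> s \<le> t \<Longrightarrow> t - s \<le> Y t - Y s"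
    using closed_expansive_selection[OF D] by blast
  define Z where "Z t = power_mean q l (X (u * t)) (Y (v * t))" for t
  have pos: "0 < X (u * t)" "0 < Y (v * t)" if "0 < t" for t
    using X(1)[of "u * t"] Y(1)[of "v * t"] C(2) D(2) uv that by auto
  have Z_pos: "0 < Z t" if "0 < t" for t
    unfolding Z_def using pos that power_mean_pos q l by blast
  have Z_exp: "k * (t - s) \<le> Z t - Z s" if st: "0 < s" "s \<le> t" for s t
  proof (cases "s = t")
    case False
    then have ts: "0 < t - s" using st by simp
    \<comment> \<open>The increment is realised as a mean too: by homogeneity
      \<open>k * (t - s)\<close> is the mean of (t - s) u and (t - s) v, so superadditivity
      applies.\<close>
    have "Z s + k * (t - s) = power_mean q l (X (u * s)) (Y (v * s))
        + power_mean q l ((t - s) * u) ((t - s) * v)"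
      unfolding Z_def k_def by (subst power_mean_scale[OF q l ts uv]) simp
    also have "\<dots> \<le> power_mean q l (X (u * s) + (t - s) * u) (Y (v * s) + (t - s) * v)"
      using pos[OF st(1)] ts uv by (intro power_mean_superadditive q l) auto
    also have "\<dots> \<le> Z t"
      unfolding Z_def
    proof (intro power_mean_mono q l)
      show "X (u * s) + (t - s) * u \<le> X (u * t)" "Y (v * s) + (t - s) * v \<le> Y (v * t)"
        using X(3)[of "u * s" "u * t"] Y(3)[of "v * s" "v * t"] uv st
        by (simp_all add: algebra_simps)
    qed (use pos[OF st(1)] ts uv in \<open>auto intro: add_pos_pos\<close>)
    finally show ?thesis by simp
  qed simp
  have Z_le: "Z t \<le> k * t + (tangent_l q l u v * a + tangent_r q l u v * b)" if t: "0 < t" for t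
  proof -
    have "Z t \<le> tangent_l q l u v * X (u * t) + tangent_r q l u v * Y (v * t)"
      unfolding Z_def by (intro power_mean_le_tangent q l uv pos t)
    also have "\<dots> \<le> tangent_l q l u v * (u * t + a) + tangent_r q l u v * (v * t + b)"
      using X(2)[of "u * t"] Y(2)[of "v * t"] uv t
      by (intro add_mono mult_left_mono tangent_nonneg q l) auto
    also have "\<dots> = (tangent_l q l u v * u + tangent_r q l u v * v) * t
        + (tangent_l q l u v * a + tangent_r q l u v * b)"
      by (simp add: algebra_simps)
    also have "tangent_l q l u v * u + tangent_r q l u v * v = k"
      unfolding k_def by (intro tangent_eq q l uv)
    finally show ?thesis .
  qed
  have avoid: "Z t \<notin> F" if "0 < t" for t
    unfolding Z_def using sep X(1) Y(1) uv that by simp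
  \<comment> \<open>\<open>Z\<close> is controlled at positive arguments only, so the comparison
    starts at a small \<open>s\<close>; this costs \<open>k * s\<close>, which is made arbitrarily
    small at the end.\<close>
  have "measure lborel (F \<inter> {0..R})
      \<le> tangent_l q l u v * a + tangent_r q l u v * b + k * s" if s: "0 < s" for s
  proof -
    \<comment> \<open>Chosen so that \<open>k * (T - s)\<close> is the absolute value of
      \<open>R\<close>; expansiveness then carries \<open>Z T\<close> past \<open>R\<close>.\<close>
    define T where "T = s + \<bar>R\<bar> / k"
    have T: "s \<le> T" "0 < T" using s k by (auto simp: T_def intro: add_pos_nonneg)
    have "R \<le> Z T"
      using Z_exp[OF s T(1)] Z_pos[OF s] k by (simp add: T_def)
    then have "measure lborel (F \<inter> {0..R}) \<le> measure lborel (F \<inter> {0..Z T})"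
      using cumulative_increment(1)[of F R "Z T"] F by simp
    also have "\<dots> \<le> Z T - k * (T - s) - (Z s - measure lborel (F \<inter> {0..Z s}))"
      using expansive_avoids_closed[OF F k Z_exp avoid s T(1)] by simp
    also have "measure lborel (F \<inter> {0..Z s}) \<le> Z s"
      using measure_mono_fmeasurable[of "F \<inter> {0..Z s}" "{0..Z s}" lborel] F Z_pos[OF s] by simp
    finally show ?thesis using Z_le[OF T(2)] by (simp add: algebra_simps)
  qed
  from this[of "e / k" for e] have "measure lborel (F \<inter> {0..R})
      \<le> tangent_l q l u v * a + tangent_r q l u v * b + e" if "0 < e" for e
    using that k by simp
  then show ?thesis by (rule field_le_epsilon)
qed

text \<open>Reduction to closed sets: \<open>A\<close>, \<open>B\<close> and \<open>F\<close> are
  approximated from inside up to length \<open>e\<close>, which preserves the separation, and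
  \<open>e\<close> tends to 0.\<close>

lemma ray_estimate:
  fixes A B F :: "real set"
  assumes q: "q \<le> 1" "q \<noteq> 0" and l: "0 < l" "l < 1" and uv: "0 < u" "0 < v"
    and A: "A \<in> sets borel" "A \<subseteq> {0<..}" and B: "B \<in> sets borel" "B \<subseteq> {0<..}"
    and F: "F \<in> sets borel" "F \<subseteq> {0<..}"
    and sep: "\<And>s t. s \<in> A \<Longrightarrow> t \<in> B \<Longrightarrow> power_mean q l s t \<notin> F"
  shows "emeasure lborel F \<le> ennreal (tangent_l q l u v) * emeasure lborel ({0<..} - A)
      + ennreal (tangent_r q l u v) * emeasure lborel ({0<..} - B)"
proof -
  define \<alpha> \<beta> where "\<alpha> = tangent_l q l u v" and "\<beta> = tangent_r q l u v"
  \<comment> \<open>Strict positivity makes the right-hand side infinite as soon as one complement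
    has infinite length; a zero coefficient would give zero times infinity, which is 0.\<close>
  have pos: "0 < \<alpha>" "0 < \<beta>"
    using power_mean_pos[OF q l uv] uv l by (auto simp: \<alpha>_def \<beta>_def tangent_l_def tangent_r_def)
  show ?thesis
  proof (cases "emeasure lborel ({0<..} - A) = \<infinity> \<or> emeasure lborel ({0<..} - B) = \<infinity>")
    case True
    then show ?thesis using pos unfolding \<alpha>_def[symmetric] \<beta>_def[symmetric]
      by (auto simp: ennreal_mult_eq_top_iff)
  next
    case False
    then obtain a b where ab: "emeasure lborel ({0<..} - A) = ennreal a" "0 \<le> a"
        "emeasure lborel ({0<..} - B) = ennreal b" "0 \<le> b"
      by (metis ennreal_cases infinity_ennreal_def)
    \<comment> \<open>The error collects \<open>\<alpha> * e\<close> and \<open>\<beta> * e\<close>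
      from the enlarged complements and one more \<open>e\<close> from the part of \<open>F\<close>
      outside its closed subset.\<close>
    have bound: "emeasure lborel F \<le> ennreal (\<alpha> * a + \<beta> * b + (\<alpha> + \<beta> + 1) * e)" if e: "0 < e" for e
    proof -
      obtain C where C: "closed C" "C \<subseteq> A" "emeasure lborel (A - C) \<le> ennreal e"
        using emeasure_lborel_closed_inner[OF A(1) e] by blast
      obtain D where D: "closed D" "D \<subseteq> B" "emeasure lborel (B - D) \<le> ennreal e"
        using emeasure_lborel_closed_inner[OF B(1) e] by blast
      obtain K where K: "closed K" "K \<subseteq> F" "emeasure lborel (F - K) \<le> ennreal e"
        using emeasure_lborel_closed_inner[OF F(1) e] by blast
      have ceq: "emeasure lborel ({0<..} - S) \<le> ennreal (x + e)"
        if "S \<subseteq> S'" "closed S" "S' \<in> sets borel" "S' \<subseteq> {0<..}" "0 \<le> x"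
          "emeasure lborel ({0<..} - S') = ennreal x" "emeasure lborel (S' - S) \<le> ennreal e"
        for S S' :: "real set" and x
      proof -
        have "{0<..} - S = ({0<..} - S') \<union> (S' - S)" using that by auto
        also have "emeasure lborel \<dots> \<le> emeasure lborel ({0<..} - S') + emeasure lborel (S' - S)"
          using that by (intro emeasure_subadditive) auto
        also have "\<dots> \<le> ennreal x + ennreal e" using that by (intro add_mono) auto
        finally show ?thesis using that e by simp
      qed
      have m: "measure lborel (K \<inter> {0..R}) \<le> \<alpha> * (a + e) + \<beta> * (b + e)" for R
        unfolding \<alpha>_def \<beta>_def
      proof (rule ray_estimate_closed[OF q l uv])
        show "emeasure lborel ({0<..} - C) \<le> ennreal (a + e)"
          using ceq[of C A a] C A ab by simp
        show "emeasure lborel ({0<..} - D) \<le> ennreal (b + e)"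
          using ceq[of D B b] D B ab by simp
        show "power_mean q l s t \<notin> K" if "s \<in> C" "t \<in> D" for s t
          using sep[of s t] that C(2) D(2) K(2) by blast
      qed (use C D K A B ab e in auto)
      have "K = (\<Union>n. K \<inter> {0..real n})"
      proof -
        have "\<exists>n. x \<le> real n" for x by (rule real_arch_simple)
        then show ?thesis using K(2) F(2) by force
      qed
      then have "emeasure lborel K = emeasure lborel (\<Union>n. K \<inter> {0..real n})" by (rule arg_cong)
      also have "\<dots> = (SUP n. emeasure lborel (K \<inter> {0..real n}))"
        using K by (intro SUP_emeasure_incseq[symmetric]) (auto simp: incseq_def)
      also have "\<dots> \<le> ennreal (\<alpha> * (a + e) + \<beta> * (b + e))"
      proof (rule SUP_least)
        fix n :: nat
        have "K \<inter> {0..real n} \<in> fmeasurable lborel" using K(1) by simp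
        then have "emeasure lborel (K \<inter> {0..real n}) = ennreal (measure lborel (K \<inter> {0..real n}))"
          by (rule emeasure_eq_measure2)
        also have "\<dots> \<le> ennreal (\<alpha> * (a + e) + \<beta> * (b + e))" by (rule ennreal_leI[OF m])
        finally show "emeasure lborel (K \<inter> {0..real n}) \<le> ennreal (\<alpha> * (a + e) + \<beta> * (b + e))" .
      qed
      finally have "emeasure lborel K \<le> ennreal (\<alpha> * (a + e) + \<beta> * (b + e))" .
      moreover have "emeasure lborel F \<le> emeasure lborel K + emeasure lborel (F - K)"
        using emeasure_subadditive[of K lborel "F - K"] K F(1) by (simp add: Un_absorb1)
      ultimately have "emeasure lborel F \<le> ennreal (\<alpha> * (a + e) + \<beta> * (b + e)) + ennreal e"
        using K(3) by (meson add_mono order_trans)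
      also have "\<dots> = ennreal (\<alpha> * a + \<beta> * b + (\<alpha> + \<beta> + 1) * e)"
        using pos ab e by (simp add: ennreal_plus[symmetric] algebra_simps del: ennreal_plus)
      finally show ?thesis .
    qed
    have "emeasure lborel F \<le> ennreal (\<alpha> * a + \<beta> * b)"
    proof (rule ennreal_le_epsilon)
      fix e :: real assume e: "0 < e"
      have "emeasure lborel F \<le> ennreal (\<alpha> * a + \<beta> * b + (\<alpha> + \<beta> + 1) * (e / (\<alpha> + \<beta> + 1)))"
        using e pos by (intro bound) auto
      then show "emeasure lborel F \<le> ennreal (\<alpha> * a + \<beta> * b) + ennreal e"
        using e pos ab by (simp add: ennreal_plus[symmetric] del: ennreal_plus)
    qed
    also have "\<dots> = ennreal \<alpha> * ennreal a + ennreal \<beta> * ennreal b"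
      using pos ab by (simp add: ennreal_mult)
    finally show ?thesis using ab by (simp add: \<alpha>_def \<beta>_def)
  qed
qed

subsection \<open>Integration over rays\<close>

text \<open>Dilation by 2 fixes the origin but multiplies its mass by a factor other than 1. So the
  mass is 0 or infinite, and sigma-finiteness excludes the latter.\<close>

lemma homogeneous_zero_null:
  fixes \<mu> :: "'a::euclidean_space measure"
  assumes q: "q \<noteq> 0" and sets: "sets \<mu> = sets borel"
    and "sigma_finite_measure \<mu>" and hom: "homogeneous_measure q \<mu>"
  shows "emeasure \<mu> {0} = 0"
proof -
  interpret sigma_finite_measure \<mu> by fact
  have "space \<mu> = UNIV" using sets_eq_imp_space_eq[OF sets] by simp
  then obtain U where U: "range U \<subseteq> sets \<mu>" "(\<Union>i. U i) = UNIV" "\<And>i::nat. emeasure \<mu> (U i) \<noteq> \<infinity>"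
    using sigma_finite by metis
  then obtain i where "0 \<in> U i" by blast
  then have "emeasure \<mu> {0} \<le> emeasure \<mu> (U i)" using U by (intro emeasure_mono) auto
  then obtain m where m: "emeasure \<mu> {0} = ennreal m" "0 \<le> m"
    using U(3)[of i] by (metis ennreal_cases infinity_ennreal_def top.extremum_unique)
  have "emeasure \<mu> ((\<lambda>x. 2 *\<^sub>R x) ` {0}) = ennreal (2 powr (1 / q)) * emeasure \<mu> {0}"
    using hom unfolding homogeneous_measure_def by (metis borel_singleton sets.empty_sets zero_less_numeral)
  then have "ennreal m = ennreal (2 powr (1 / q) * m)" using m by (simp add: ennreal_mult)
  then have "m = 2 powr (1 / q) * m" using m by (simp add: ennreal_inj)
  moreover have "2 powr (1 / q) \<noteq> (1::real)" using q by simp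
  ultimately show ?thesis using m by simp
qed

text \<open>The shell plays the role of the unit sphere: every punctured ray \<open>s powr (- q) *\<^sub>R y\<close> meets it in a
  set of mass 1 with respect to \<open>ds / s\<close>. The origin is excluded because \<open>0 powr (1 / q) = 0\<close>.\<close>

definition gauge_shell :: "real \<Rightarrow> 'a::euclidean_space set" where
  "gauge_shell q = {x. 1 \<le> norm x powr (1 / q) \<and> norm x powr (1 / q) < exp 1}"

lemma gauge_shell_borel [measurable]: "gauge_shell q \<in> sets borel"
  unfolding gauge_shell_def by measurable

lemma zero_notin_gauge_shell: "0 \<notin> gauge_shell q"
  by (simp add: gauge_shell_def)

lemma powr_minus_powr_inverse:
  fixes s q :: real
  assumes "0 < s" "q \<noteq> 0"
  shows "(s powr (- q)) powr (1 / q) = 1 / s"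
proof -
  have "(s powr (- q)) powr (1 / q) = s powr (- q * (1 / q))" by (rule powr_powr)
  also have "- q * (1 / q) = - 1" using assms by simp
  finally show ?thesis using assms by (simp add: powr_minus_divide)
qed

text \<open>With \<open>N\<close> the gauge of \<open>y\<close>, the point at parameter
  \<open>s\<close> has gauge N / s. It lies in the shell exactly for \<open>s\<close> between N / e
  and N, with e the base of the natural logarithm, and there ds / s has mass 1.\<close>

lemma nn_integral_gauge_shell:
  fixes y :: "'a::euclidean_space"
  assumes q: "q \<noteq> 0" and y: "y \<noteq> 0"
  shows "(\<integral>\<^sup>+s. indicator {0<..} s *
      (ennreal (1 / s) * indicator (gauge_shell q) (s powr (- q) *\<^sub>R y)) \<partial>lborel) = 1"
    (is "(\<integral>\<^sup>+s. ?g s \<partial>lborel) = 1")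
proof -
  define N where "N = norm y powr (1 / q)"
  have N: "0 < N" using y by (simp add: N_def)
  have mem: "s powr (- q) *\<^sub>R y \<in> gauge_shell q \<longleftrightarrow> N / exp 1 < s \<and> s \<le> N" if "0 < s" for s
  proof -
    have "norm (s powr (- q) *\<^sub>R y) powr (1 / q) = N / s"
      using powr_minus_powr_inverse[OF that q] by (simp add: N_def powr_mult)
    then have "s powr (- q) *\<^sub>R y \<in> gauge_shell q \<longleftrightarrow> 1 \<le> N / s \<and> N / s < exp 1"
      unfolding gauge_shell_def by simp
    then show ?thesis using that by (auto simp: field_simps)
  qed
  have "(\<integral>\<^sup>+s. ?g s \<partial>lborel)
      = (\<integral>\<^sup>+s. ennreal (1 / s) * indicator {N / exp 1..N} s \<partial>lborel)"
  proof (rule nn_integral_cong_AE)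
    \<comment> \<open>The parameter interval is open on the left; its missing endpoint is a null
      set.\<close>
    have "AE s in lborel. s \<noteq> N / exp 1" by (rule AE_lborel_singleton)
    then show "AE s in lborel. ?g s
        = ennreal (1 / s) * indicator {N / exp 1..N} s"
    proof eventually_elim
      case (elim s)
      show ?case
      proof (cases "0 < s")
        case True
        then show ?thesis using mem[OF True] elim by (auto simp: indicator_def)
      next
        case False
        moreover have "0 < N / exp 1" using N by simp
        ultimately show ?thesis by (auto simp: indicator_def)
      qed
    qed
  qed
  also have "\<dots> = ennreal (ln N - ln (N / exp 1))"
  proof (rule nn_integral_FTC_Icc)
    fix x assume "x \<in> {N / exp 1..N}"
    moreover have "0 < N / exp 1" using N by simp
    ultimately have "0 < x" by (metis atLeastAtMost_iff order_less_le_trans)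
    then show "(ln has_real_derivative 1 / x) (at x)" "0 \<le> 1 / x"
      by (auto intro!: DERIV_ln_divide)
  next
    have "1 \<le> exp (1::real)" by simp
    then show "N / exp 1 \<le> N" using N by (simp add: field_simps)
  qed measurable
  also have "ln N - ln (N / exp 1) = 1" using N by (simp add: ln_div)
  finally show ?thesis by simp
qed

text \<open>Polar coordinates from Fubini: for fixed \<open>s\<close>, dilation by
  \<open>s powr (- q)\<close> changes mass by the factor 1 / s. After exchanging the integrals back,
  each nonzero point of \<open>E\<close> is counted with total weight 1 by the normalisation of the
  shell.\<close>

lemma homogeneous_polar:
  fixes \<mu> :: "'a::euclidean_space measure"
  assumes q: "q \<noteq> 0" and sets: "sets \<mu> = sets borel"
    and sf: "sigma_finite_measure \<mu>" and hom: "homogeneous_measure q \<mu>"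
    and E: "E \<in> sets borel"
  shows "emeasure \<mu> E
    = (\<integral>\<^sup>+x. indicator (gauge_shell q) x * emeasure lborel {s \<in> {0<..}. s powr q *\<^sub>R x \<in> E} \<partial>\<mu>)"
proof -
  let ?S = "gauge_shell q :: 'a set"
  let ?g = "\<lambda>y s. indicator {0<..} s * (ennreal (1 / s) *
    indicator ?S (s powr (- q) *\<^sub>R y)) :: ennreal"
  let ?h = "\<lambda>x s. indicator {0<..} s * indicator E (s powr q *\<^sub>R x) :: ennreal"
  interpret \<mu>: sigma_finite_measure \<mu> by fact
  interpret pair_sigma_finite \<mu> "lborel :: real measure" ..
  note [measurable_cong] = sets
  note [measurable] = E
  have "(\<integral>\<^sup>+x. indicator ?S x * emeasure lborel {s \<in> {0<..}. s powr q *\<^sub>R x \<in> E} \<partial>\<mu>)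
      = (\<integral>\<^sup>+x. \<integral>\<^sup>+s. indicator ?S x * ?h x s \<partial>lborel \<partial>\<mu>)"
  proof (intro nn_integral_cong)
    fix x
    have "emeasure lborel {s \<in> {0<..}. s powr q *\<^sub>R x \<in> E}
        = (\<integral>\<^sup>+s. indicator {s \<in> {0<..}. s powr q *\<^sub>R x \<in> E} s \<partial>lborel)"
      by (intro nn_integral_indicator[symmetric]) measurable
    also have "\<dots> = (\<integral>\<^sup>+s. indicator {0<..} s * indicator E (s powr q *\<^sub>R x) \<partial>lborel)"
      by (intro nn_integral_cong) (auto simp: indicator_def)
    finally show "indicator ?S x * emeasure lborel {s \<in> {0<..}. s powr q *\<^sub>R x \<in> E}
        = (\<integral>\<^sup>+s. indicator ?S x * ?h x s \<partial>lborel)"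
      by (subst nn_integral_cmult) auto
  qed
  also have "\<dots> = (\<integral>\<^sup>+s. \<integral>\<^sup>+x. indicator ?S x * ?h x s \<partial>\<mu> \<partial>lborel)"
    by (rule Fubini'[symmetric]) measurable
  also have "\<dots> = (\<integral>\<^sup>+s. \<integral>\<^sup>+y. indicator E y * ?g y s \<partial>\<mu> \<partial>lborel)"
  proof (rule nn_integral_cong)
    fix s :: real
    show "(\<integral>\<^sup>+x. indicator ?S x * ?h x s \<partial>\<mu>)
        = (\<integral>\<^sup>+y. indicator E y * ?g y s \<partial>\<mu>)"
    proof (cases "0 < s")
      case True
      \<comment> \<open>The preimage of the integration set under dilation by
        \<open>s powr (- q)\<close>, so that homogeneity expresses the mass of that set through the
        mass of \<open>T\<close>.\<close>
      define T where "T = {y \<in> E. s powr (- q) *\<^sub>R y \<in> ?S}"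
      have T [measurable]: "T \<in> sets borel" unfolding T_def by measurable
      have c: "s powr q * s powr - q = 1" using True by (simp add: powr_minus)
      have im: "(\<lambda>y. s powr (- q) *\<^sub>R y) ` T = {x \<in> ?S. s powr q *\<^sub>R x \<in> E}"
      proof (intro set_eqI iffI)
        fix x assume "x \<in> {x \<in> ?S. s powr q *\<^sub>R x \<in> E}"
        then show "x \<in> (\<lambda>y. s powr (- q) *\<^sub>R y) ` T"
          using c by (intro image_eqI[of _ _ "s powr q *\<^sub>R x"]) (auto simp: T_def mult.commute)
      qed (use c in \<open>auto simp: T_def\<close>)
      have "(\<integral>\<^sup>+x. indicator ?S x * ?h x s \<partial>\<mu>)
          = (\<integral>\<^sup>+x. indicator {x \<in> ?S. s powr q *\<^sub>R x \<in> E} x \<partial>\<mu>)"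
        using True by (intro nn_integral_cong) (auto simp: indicator_def)
      also have "\<dots> = emeasure \<mu> {x \<in> ?S. s powr q *\<^sub>R x \<in> E}"
        by (intro nn_integral_indicator) measurable
      also have "\<dots> = ennreal ((s powr (- q)) powr (1 / q)) * emeasure \<mu> T"
        using hom True T unfolding homogeneous_measure_def im[symmetric] by simp
      also have "(s powr (- q)) powr (1 / q) = 1 / s"
        by (rule powr_minus_powr_inverse[OF True q])
      also have "emeasure \<mu> T = (\<integral>\<^sup>+y. indicator T y \<partial>\<mu>)"
        by (intro nn_integral_indicator[symmetric]) measurable
      also have "ennreal (1 / s) * \<dots> = (\<integral>\<^sup>+y. ennreal (1 / s) * indicator T y \<partial>\<mu>)"
        by (intro nn_integral_cmult[symmetric]) measurable
      also have "\<dots> = (\<integral>\<^sup>+y. indicator E y * ?g y s \<partial>\<mu>)"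
        using True by (intro nn_integral_cong) (auto simp: indicator_def T_def)
      finally show ?thesis .
    qed simp
  qed
  also have "\<dots> = (\<integral>\<^sup>+y. \<integral>\<^sup>+s. indicator E y * ?g y s \<partial>lborel \<partial>\<mu>)"
    by (rule Fubini') measurable
  \<comment> \<open>At the origin the inner integral is 0 rather than 1, since the shell omits it;
    this loses nothing because the origin has mass 0.\<close>
  also have "\<dots> = (\<integral>\<^sup>+y. indicator (E - {0}) y \<partial>\<mu>)"
  proof (intro nn_integral_cong)
    fix y
    have "(\<integral>\<^sup>+s. indicator E y * ?g y s \<partial>lborel)
        = indicator E y * (\<integral>\<^sup>+s. ?g y s \<partial>lborel)"
      by (intro nn_integral_cmult) measurable
    also have "\<dots> = indicator (E - {0}) y"
    proof (cases "y = 0")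
      case True
      then show ?thesis using zero_notin_gauge_shell[of q, where 'a='a] by simp
    next
      case False
      then show ?thesis using nn_integral_gauge_shell[OF q False] by (auto simp: indicator_def)
    qed
    finally show "(\<integral>\<^sup>+s. indicator E y * ?g y s \<partial>lborel)
        = indicator (E - {0}) y" .
  qed
  also have "\<dots> = emeasure \<mu> (E - {0})" using E sets by (intro nn_integral_indicator) auto
  also have "\<dots> = emeasure \<mu> E"
    using homogeneous_zero_null[OF q sets sf hom] E sets
    by (intro emeasure_Diff_null_set) (auto intro: null_setsI)
  finally show ?thesis by simp
qed

section \<open>From rays to the measure\<close>

text \<open>The reason for the coordinate \<open>s powr q\<close>: the \<open>q\<close>-th power of
  the mean is the convex combination of the \<open>q\<close>-th powers.\<close>

lemma minkowski_comb_ray: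
  assumes "0 < s" "0 < t" "q \<le> 1" "q \<noteq> 0" "0 < l" "l < 1"
    and "s powr q *\<^sub>R x \<in> A" "t powr q *\<^sub>R x \<in> B"
  shows "power_mean q l s t powr q *\<^sub>R x \<in> minkowski_comb l A B"
proof -
  have "power_mean q l s t powr q *\<^sub>R x = l *\<^sub>R (s powr q *\<^sub>R x) + (1 - l) *\<^sub>R (t powr q *\<^sub>R x)"
    using assms by (simp add: power_mean_powr scaleR_add_left)
  then show ?thesis using assms(7,8) unfolding minkowski_comb_def by blast
qed

text \<open>The ray estimate has the same coefficients on every ray, so the polar formula integrates
  it into an estimate between the measures of \<open>F\<close> and of the two complements.\<close>

lemma homogeneous_tangent_bound:
  fixes \<mu> :: "'a::euclidean_space measure"
  assumes q: "q \<le> 1" "q \<noteq> 0" and l: "0 < l" "l < 1" and uv: "0 < u" "0 < v"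
    and sets: "sets \<mu> = sets borel" and sf: "sigma_finite_measure \<mu>"
    and hom: "homogeneous_measure q \<mu>"
    and A: "A \<in> sets borel" and B: "B \<in> sets borel" and F: "F \<in> sets borel"
    and F_sub: "F \<subseteq> - minkowski_comb l A B"
  shows "emeasure \<mu> F \<le> ennreal (tangent_l q l u v) * emeasure \<mu> (- A)
      + ennreal (tangent_r q l u v) * emeasure \<mu> (- B)"
proof -
  define ray :: "'a set \<Rightarrow> 'a \<Rightarrow> real set" where "ray E x = {s \<in> {0<..}. s powr q *\<^sub>R x \<in> E}" for E x
  define \<alpha> \<beta> where "\<alpha> = ennreal (tangent_l q l u v)" and "\<beta> = ennreal (tangent_r q l u v)"
  define S where "S = (gauge_shell q :: 'a set)"
  note [measurable_cong] = sets
  note [measurable] = A B F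
  have polar: "emeasure \<mu> E = (\<integral>\<^sup>+x. indicator S x * emeasure lborel (ray E x) \<partial>\<mu>)"
    if "E \<in> sets borel" for E
    unfolding ray_def S_def by (rule homogeneous_polar[OF q(2) sets sf hom that])
  have ray_borel: "ray E x \<in> sets borel" if [measurable]: "E \<in> sets borel" for E x
    unfolding ray_def by measurable
  have ray_compl: "ray (- E) x = {0<..} - ray E x" for E x
    by (auto simp: ray_def)
  have ray_meas: "(\<lambda>x. emeasure lborel (ray E x)) \<in> borel_measurable \<mu>"
    if [measurable]: "E \<in> sets borel" for E
  proof -
    have "(\<lambda>x. \<integral>\<^sup>+s. indicator {0<..} s * indicator E (s powr q *\<^sub>R x) \<partial>(lborel :: real measure))
        \<in> borel_measurable \<mu>"
      by measurable
    also have "(\<lambda>x. \<integral>\<^sup>+s. indicator {0<..} s * indicator E (s powr q *\<^sub>R x) \<partial>(lborel :: real measure))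
        = (\<lambda>x. emeasure lborel (ray E x))"
    proof
      fix x
      have "(\<integral>\<^sup>+s. indicator {0<..} s * indicator E (s powr q *\<^sub>R x) \<partial>(lborel :: real measure))
          = (\<integral>\<^sup>+s. indicator (ray E x) s \<partial>lborel)"
        by (intro nn_integral_cong) (auto simp: indicator_def ray_def)
      then show "(\<integral>\<^sup>+s. indicator {0<..} s * indicator E (s powr q *\<^sub>R x) \<partial>(lborel :: real measure))
          = emeasure lborel (ray E x)"
        using ray_borel[OF that] by simp
    qed
    finally show ?thesis .
  qed
  have S [measurable]: "S \<in> sets borel" unfolding S_def by measurable
  have cA: "- A \<in> sets borel" and cB: "- B \<in> sets borel" using A B by auto
  note [measurable] = ray_meas[OF cA] ray_meas[OF cB]
  \<comment> \<open>Only combinations of points on the same ray are used; they already force the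
    trace of \<open>F\<close> to avoid all means of the traces of \<open>A\<close> and
    \<open>B\<close>.\<close>
  have "emeasure lborel (ray F x)
      \<le> \<alpha> * emeasure lborel (ray (- A) x) + \<beta> * emeasure lborel (ray (- B) x)" for x
    unfolding \<alpha>_def \<beta>_def ray_compl
  proof (rule ray_estimate[OF q l uv])
    fix s t assume "s \<in> ray A x" "t \<in> ray B x"
    then have "power_mean q l s t powr q *\<^sub>R x \<in> minkowski_comb l A B"
      by (intro minkowski_comb_ray q l) (auto simp: ray_def)
    then show "power_mean q l s t \<notin> ray F x" using F_sub by (auto simp: ray_def)
  qed (use A B F ray_borel in \<open>auto simp: ray_def\<close>)
  then have "emeasure \<mu> F \<le> (\<integral>\<^sup>+x. indicator S x *
      (\<alpha> * emeasure lborel (ray (- A) x) + \<beta> * emeasure lborel (ray (- B) x)) \<partial>\<mu>)"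
    unfolding polar[OF F] by (intro nn_integral_mono mult_left_mono) auto
  also have "\<dots> = (\<integral>\<^sup>+x. \<alpha> * (indicator S x * emeasure lborel (ray (- A) x))
      + \<beta> * (indicator S x * emeasure lborel (ray (- B) x)) \<partial>\<mu>)"
    by (intro nn_integral_cong) (simp add: distrib_left mult.left_commute)
  also have "\<dots> = \<alpha> * emeasure \<mu> (- A) + \<beta> * emeasure \<mu> (- B)"
    unfolding polar[OF cA] polar[OF cB] by (simp add: nn_integral_add nn_integral_cmult)
  finally show ?thesis by (simp add: \<alpha>_def \<beta>_def)
qed

section \<open>Continuity of the mean at the boundary, and conclusion\<close>

lemma power_mean_tendsto_0:
  assumes q: "q \<le> 1" "q \<noteq> 0" and l: "0 < l" "l < 1" and ab: "0 \<le> a" "0 \<le> b"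
  shows "((\<lambda>e. power_mean q l (a + e) (b + e)) \<longlongrightarrow> power_mean q l a b) (at_right 0)"
proof -
  have ev: "\<forall>\<^sub>F e in at_right (0::real). 0 < e" by (simp add: eventually_at_right_less)
  have eq: "\<forall>\<^sub>F e in at_right 0. power_mean q l (a + e) (b + e)
      = (l * (a + e) powr q + (1 - l) * (b + e) powr q) powr (1 / q)"
    using ev by eventually_elim (use ab in \<open>simp add: power_mean_pos_eq\<close>)
  have lim: "((\<lambda>e. c + e) \<longlongrightarrow> c) (at_right 0)" for c :: real
    by (auto intro!: tendsto_eq_intros)
  show ?thesis
  proof (cases "q < 0 \<and> (a = 0 \<or> b = 0)")
    case False
    \<comment> \<open>The side condition for continuity of \<open>powr\<close>: a zero base is
      harmless for a positive exponent, and for \<open>q < 0\<close> this case has no zero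
      base.\<close>
    have nz: "c \<noteq> 0 \<or> 0 < q \<and> (\<forall>\<^sub>F e in at_right 0. 0 \<le> c + e)" if "c = a \<or> c = b" for c
    proof (cases "0 < q")
      case True
      have "\<forall>\<^sub>F e in at_right 0. 0 \<le> c + e" using ev by eventually_elim (use ab that in auto)
      then show ?thesis using True by simp
    qed (use that False q in auto)
    have "((\<lambda>e. (l * (a + e) powr q + (1 - l) * (b + e) powr q) powr (1 / q))
        \<longlongrightarrow> (l * a powr q + (1 - l) * b powr q) powr (1 / q)) (at_right 0)"
    proof (intro tendsto_powr' tendsto_add tendsto_mult tendsto_const lim)
      show "a \<noteq> 0 \<or> 0 < q \<and> (\<forall>\<^sub>F e in at_right 0. 0 \<le> a + e)"
        "b \<noteq> 0 \<or> 0 < q \<and> (\<forall>\<^sub>F e in at_right 0. 0 \<le> b + e)"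
        by (rule nz, simp)+
      show "l * a powr q + (1 - l) * b powr q \<noteq> 0
          \<or> 0 < 1 / q \<and> (\<forall>\<^sub>F e in at_right 0. 0 \<le> l * (a + e) powr q + (1 - l) * (b + e) powr q)"
      proof (cases "0 < q")
        case True
        have "0 \<le> l * (a + e) powr q + (1 - l) * (b + e) powr q" for e
          using l by (intro add_nonneg_nonneg mult_nonneg_nonneg) auto
        then show ?thesis using True by simp
      next
        case neg: False
        then have "0 < a" "0 < b" using False q ab by auto
        then show ?thesis using power_sum_pos[OF q l, of a b] by simp
      qed
    qed
    also have "(l * a powr q + (1 - l) * b powr q) powr (1 / q) = power_mean q l a b"
      using False by (auto simp: power_mean_def)
    finally show ?thesis by (simp only: filterlim_cong[OF refl refl eq])
  next
    case True
    \<comment> \<open>For \<open>q < 0\<close> a vanishing argument becomes \<open>e\<close>, and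
      its term alone is at least \<open>m * e powr q\<close> whichever argument it is. The negative
      power \<open>1 / q\<close> turns this into an upper bound linear in \<open>e\<close>.\<close>
    define m where "m = min l (1 - l)"
    have m: "0 < m" "m \<le> l" "m \<le> 1 - l" using l by (auto simp: m_def)
    have bound: "power_mean q l (a + e) (b + e) \<le> m powr (1 / q) * e" if e: "0 < e" for e
    proof -
      have "m * e powr q \<le> l * (a + e) powr q + (1 - l) * (b + e) powr q"
      proof (cases "a = 0")
        case True
        have "m * e powr q \<le> l * (a + e) powr q" using m True by (simp add: mult_right_mono)
        then show ?thesis using l by (simp add: add_increasing2)
      next
        case False
        then have "m * e powr q \<le> (1 - l) * (b + e) powr q"
          using m True by (simp add: mult_right_mono)
        then show ?thesis using l by (simp add: add_increasing)
      qed
      then have "power_mean q l (a + e) (b + e) \<le> (m * e powr q) powr (1 / q)"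
        using True m e ab by (simp add: power_mean_pos_eq powr_mono2')
      also have "\<dots> = m powr (1 / q) * e" using m e q by (simp add: powr_mult powr_powr)
      finally show ?thesis .
    qed
    have lim0: "((\<lambda>e. m powr (1 / q) * e) \<longlongrightarrow> 0) (at_right 0)"
      by (auto intro!: tendsto_eq_intros)
    have "((\<lambda>e. power_mean q l (a + e) (b + e)) \<longlongrightarrow> 0) (at_right 0)"
    proof (rule tendsto_sandwich[OF _ _ tendsto_const lim0])
      show "\<forall>\<^sub>F e in at_right 0. 0 \<le> power_mean q l (a + e) (b + e)"
        by (simp add: power_mean_def)
      show "\<forall>\<^sub>F e in at_right 0. power_mean q l (a + e) (b + e) \<le> m powr (1 / q) * e"
        using ev by eventually_elim (rule bound)
    qed
    then show ?thesis using True by (simp add: power_mean_def)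
  qed
qed

theorem theorem4p3:
  fixes \<mu> :: "(real ^ 'n) measure" and q :: real
  assumes "q \<le> 1" and "q \<noteq> 0"
    and "sets \<mu> = sets borel"
    and "sigma_finite_measure \<mu>"
    and "homogeneous_measure q \<mu>"
  shows "complemented_concave q \<mu>"
  unfolding complemented_concave_def inner_measure_def
proof (intro allI impI SUP_least)
  fix l :: real and A B F :: "(real ^ 'n) set"
  assume l: "0 < l" "l < 1" and A: "A \<in> sets borel" and B: "B \<in> sets borel"
    and fin: "emeasure \<mu> (- A) < \<infinity>" "emeasure \<mu> (- B) < \<infinity>"
    and F: "F \<in> {F \<in> sets borel. F \<subseteq> - minkowski_comb l A B}"
  define a b where "a = measure \<mu> (- A)" and "b = measure \<mu> (- B)"
  have ab: "0 \<le> a" "0 \<le> b" by (simp_all add: a_def b_def)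
  have em: "emeasure \<mu> (- A) = ennreal a" "emeasure \<mu> (- B) = ennreal b"
    using fin by (simp_all add: a_def b_def emeasure_eq_ennreal_measure)
  \<comment> \<open>The tangent point should be (a, b), but \<open>a\<close> or \<open>b\<close> may
    be 0 and tangents exist at positive points only. Both are shifted by \<open>e\<close>; Euler's
    identity turns the linear bound into the mean.\<close>
  have bound: "emeasure \<mu> F \<le> ennreal (power_mean q l (a + e) (b + e))" if e: "0 < e" for e
  proof -
    let ?\<alpha> = "tangent_l q l (a + e) (b + e)" and ?\<beta> = "tangent_r q l (a + e) (b + e)"
    have pos: "0 < a + e" "0 < b + e" using ab e by simp_all
    have nn: "0 \<le> ?\<alpha>" "0 \<le> ?\<beta>" using tangent_nonneg assms(1,2) l by blast+
    have "emeasure \<mu> F \<le> ennreal ?\<alpha> * ennreal a + ennreal ?\<beta> * ennreal b"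
      using homogeneous_tangent_bound[OF assms(1,2) l pos assms(3-5) A B] F em by simp
    also have "\<dots> = ennreal (?\<alpha> * a + ?\<beta> * b)" using nn ab by (simp add: ennreal_mult)
    also have "?\<alpha> * a + ?\<beta> * b \<le> ?\<alpha> * (a + e) + ?\<beta> * (b + e)"
      using nn e by (intro add_mono mult_left_mono) auto
    also have "\<dots> = power_mean q l (a + e) (b + e)" by (intro tangent_eq assms(1,2) l pos)
    finally show ?thesis by (simp add: ennreal_leI)
  qed
  have "((\<lambda>e. ennreal (power_mean q l (a + e) (b + e))) \<longlongrightarrow> ennreal (power_mean q l a b)) (at_right 0)"
    by (intro tendsto_ennrealI power_mean_tendsto_0 assms(1,2) l ab)
  then have "emeasure \<mu> F \<le> ennreal (power_mean q l a b)"
  proof (rule tendsto_lowerbound)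
    have "\<forall>\<^sub>F e in at_right (0::real). 0 < e" by (simp add: eventually_at_right_less)
    then show "\<forall>\<^sub>F e in at_right 0. emeasure \<mu> F \<le> ennreal (power_mean q l (a + e) (b + e))"
      by eventually_elim (rule bound)
  qed simp
  then show "emeasure \<mu> F \<le> ennreal (power_mean q l (measure \<mu> (- A)) (measure \<mu> (- B)))"
    by (simp add: a_def b_def)
qed

end
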